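(* Let $S$ be a regular semigroup and $E=E(S)$ its biordered set of idempotents. Let $\phi: IG(E)\to RIG(E)$ be the natural homomorphism that is the identity on the generators $E$. Then $\phi$ restricts to a bijection from the set of regular elements of $IG(E)$ onto $RIG(E)$: for every $r\in RIG(E)$ there is a unique regular element $s\in IG(E)$ with $\phi(s)=r$. In particular, for every $e\in E$, $\phi$ restricts to an isomorphism from the maximal subgroup of $IG(E)$ containing $e$ onto the maximal subgroup of $RIG(E)$ containing $e$.
   Context: For idempotents $e,f$: $e\,\mathcal R\,f$ iff $ef=f,\ fe=e$; $e\,\mathcal L\,f$ iff $ef=e,\ fe=f$; $e\,\omega^r f$ iff $fe=e$; $e\,\omega^l f$ iff $ef=e$. A product $ef$ ($e,f\in E$) is basic if $e\,\omega^r f$, $e\,\omega^l f$, $f\,\omega^r e$ or $f\,\omega^l e$; then $ef\in E$. The biordered set of $S$ is $E$ with the partial multiplication given by basic products. The sandwich set of $e,f\in E$ is $S(e,f)=\{h\in E: ehf=ef,\ fhe=h\}$. The free idempotent generated semigroup is $IG(E)=\langle E\mid e^2=e\ (e\in E);\ e\cdot f=ef \text{ whenever } ef \text{ is a basic product}\rangle$, and the free regular idempotent generated semigroup is $RIG(E)$, given by the same presentation with the additional relations $ef=ehf$ for all $e,f\in E$ and $h\in S(e,f)$. (It is known that $E$ is exactly the set of idempotents of both $IG(E)$ and $RIG(E)$, with the same biordered structure, and that $RIG(E)$ is regular.) The maximal subgroup containing an idempotent $e$ is the group of units of the monoid $eTe$ for $T=IG(E)$ or $RIG(E)$. *)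

theory Defs
  imports Main
begin

text \<open>The regular semigroup S is the whole carrier of a type of class semigroup_mult.
  Elements of IG(E) and RIG(E) are represented by nonempty words over E (lists),
  modulo the congruences generated by the defining relations; the product is
  concatenation.  The natural map phi: IG(E) -> RIG(E) sends the IG-class of a
  word to its RIG-class.\<close>

definition idems :: "'a::semigroup_mult set" where
  "idems = {e. e * e = e}"

definition omega_r :: "'a::semigroup_mult \<Rightarrow> 'a \<Rightarrow> bool" where
  "omega_r e f \<longleftrightarrow> f * e = e"

definition omega_l :: "'a::semigroup_mult \<Rightarrow> 'a \<Rightarrow> bool" where
  "omega_l e f \<longleftrightarrow> e * f = e"

definition basic_pair :: "'a::semigroup_mult \<Rightarrow> 'a \<Rightarrow> bool" where
  "basic_pair e f \<longleftrightarrow> e \<in> idems \<and> f \<in> idems \<and>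
     (omega_r e f \<or> omega_l e f \<or> omega_r f e \<or> omega_l f e)"

definition sandwich :: "'a::semigroup_mult \<Rightarrow> 'a \<Rightarrow> 'a set" where
  "sandwich e f = {h \<in> idems. e * h * f = e * f \<and> f * h * e = h}"

definition words :: "'a::semigroup_mult list set" where
  "words = {w. w \<noteq> [] \<and> set w \<subseteq> idems}"

inductive ig_rel :: "'a::semigroup_mult list \<Rightarrow> 'a list \<Rightarrow> bool" where
  idem: "e \<in> idems \<Longrightarrow> ig_rel [e, e] [e]"
| basic: "basic_pair e f \<Longrightarrow> ig_rel [e, f] [e * f]"

inductive rig_rel :: "'a::semigroup_mult list \<Rightarrow> 'a list \<Rightarrow> bool" where
  ig: "ig_rel u v \<Longrightarrow> rig_rel u v"
| sw: "e \<in> idems \<Longrightarrow> f \<in> idems \<Longrightarrow> h \<in> sandwich e f \<Longrightarrow> rig_rel [e, f] [e, h, f]"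

inductive cong_gen :: "('a::semigroup_mult list \<Rightarrow> 'a list \<Rightarrow> bool) \<Rightarrow> 'a list \<Rightarrow> 'a list \<Rightarrow> bool"
  for R where
  step: "R u v \<Longrightarrow> set p \<subseteq> idems \<Longrightarrow> set q \<subseteq> idems \<Longrightarrow> cong_gen R (p @ u @ q) (p @ v @ q)"
| refl: "w \<in> words \<Longrightarrow> cong_gen R w w"
| sym: "cong_gen R u v \<Longrightarrow> cong_gen R v u"
| trans: "cong_gen R u v \<Longrightarrow> cong_gen R v w \<Longrightarrow> cong_gen R u w"

abbreviation eqIG :: "'a::semigroup_mult list \<Rightarrow> 'a list \<Rightarrow> bool" where
  "eqIG \<equiv> cong_gen ig_rel"

abbreviation eqRIG :: "'a::semigroup_mult list \<Rightarrow> 'a list \<Rightarrow> bool" where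
  "eqRIG \<equiv> cong_gen rig_rel"

definition regular_el :: "('a::semigroup_mult list \<Rightarrow> 'a list \<Rightarrow> bool) \<Rightarrow> 'a list \<Rightarrow> bool" where
  "regular_el eq w \<longleftrightarrow> w \<in> words \<and> (\<exists>v \<in> words. eq (w @ v @ w) w)"

text \<open>The class of w lies in the maximal subgroup containing e, i.e. the group of units
  of the monoid eTe (with identity e).\<close>
definition in_maxsub :: "('a::semigroup_mult list \<Rightarrow> 'a list \<Rightarrow> bool) \<Rightarrow> 'a \<Rightarrow> 'a list \<Rightarrow> bool" where
  "in_maxsub eq e w \<longleftrightarrow> w \<in> words \<and> (\<exists>t \<in> words. eq w ([e] @ t @ [e])) \<and>
     (\<exists>v \<in> words. (\<exists>t \<in> words. eq v ([e] @ t @ [e])) \<and> eq (w @ v) [e] \<and> eq (v @ w) [e])"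

end

theory Submission
  imports Defs
begin

text \<open>
  \<^item> Idempotents of IG(E) are letters. If \<open>u\<close> is an idempotent represented by a word \<open>v\<close>, the
    cut points of the word \<open>v\<close>...\<open>v\<close> with \<open>n\<close> factors can be followed through the rewriting that
    leads back to \<open>v\<close>. For \<open>n\<close> larger than the length of \<open>v\<close> two of them have to meet, and they
    can do so only at a letter that is D-related to \<open>u\<close>. An element of IG(E) that is L-related or
    R-related to a letter is a product of a chain of successively L- or R-related letters,
    which puts \<open>u\<close> into the H-class of its value in S.
  \<^item> If \<open>p\<close> in IG(E) is L-related to \<open>f\<close> in E, the element \<open>p h e\<close> does not depend on the choice
    of \<open>f\<close> and \<open>h\<close> in \<open>S(f,e)\<close>. These products define an action of RIG(E) on the regular elements
    of IG(E). By the chain description, a regular \<open>s\<close> that is R-related to \<open>k\<close> in E is the result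
    of letting the word \<open>s\<close> act on \<open>k\<close>, so \<open>s\<close> is determined by its image in RIG(E). Performing
    the insertions of \<open>h\<close> letter by letter on a word gives a regular preimage of it.
\<close>

section \<open>The monoid of words modulo the relations of IG(E)\<close>

lemma basic_pair_idems:
  fixes e f :: "'a::semigroup_mult"
  assumes "basic_pair e f"
  shows "e \<in> idems" "f \<in> idems" "e * f \<in> idems"
proof -
  show e: "e \<in> idems" and f: "f \<in> idems"
    using assms by (auto simp: basic_pair_def)
  have ee: "e * e = e" and ff: "f * f = f" using e f by (auto simp: idems_def)
  from assms consider "f * e = e" | "e * f = e" | "e * f = f" | "f * e = f"
    by (auto simp: basic_pair_def omega_r_def omega_l_def)
  then have "e * f * (e * f) = e * f"
    using ee ff by cases (metis mult.assoc)+
  then show "e * f \<in> idems" by (simp add: idems_def)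
qed

lemma basic_pairI:
  assumes "e \<in> idems" "f \<in> idems" "f * e = e \<or> e * f = e \<or> e * f = f \<or> f * e = f"
  shows "basic_pair e f"
  using assms by (auto simp: basic_pair_def omega_r_def omega_l_def)

text \<open>A relation \<open>e e = e\<close> is itself an instance of a basic product, so basic
  products alone generate the congruence of IG(E).\<close>

lemma ig_relE:
  assumes "ig_rel u v"
  obtains e f where "basic_pair e f" "u = [e, f]" "v = [e * f]"
  using assms
proof cases
  case (idem e)
  then have "basic_pair e e" "e * e = e"
    by (auto intro: basic_pairI simp: idems_def)
  then show ?thesis using idem that by metis
qed (use that in blast)

text \<open>Dropping the side conditions on letters makes the congruence total on lists, so that the
  quotient is a monoid in which the letters outside E are free; on words over E
  it agrees with the congruence of IG(E).\<close>

inductive ig_cong :: "'a::semigroup_mult list \<Rightarrow> 'a list \<Rightarrow> bool" where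
  step: "basic_pair e f \<Longrightarrow> ig_cong (p @ [e, f] @ q) (p @ [e * f] @ q)"
| refl: "ig_cong w w"
| sym: "ig_cong u v \<Longrightarrow> ig_cong v u"
| trans: "ig_cong u v \<Longrightarrow> ig_cong v w \<Longrightarrow> ig_cong u w"

lemma ig_cong_append_left: "ig_cong u v \<Longrightarrow> ig_cong (p @ u) (p @ v)"
proof (induction rule: ig_cong.induct)
  case (step e f x y)
  then show ?case using ig_cong.step[of e f "p @ x" y] by simp
qed (auto intro: ig_cong.intros)

lemma ig_cong_append_right: "ig_cong u v \<Longrightarrow> ig_cong (u @ p) (v @ p)"
proof (induction rule: ig_cong.induct)
  case (step e f x y)
  then show ?case using ig_cong.step[of e f x "y @ p"] by simp
qed (auto intro: ig_cong.intros)

quotient_type (overloaded) 'a igm = "'a::semigroup_mult list" / ig_cong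
  by (rule equivpI) (auto intro!: reflpI sympI transpI intro: ig_cong.intros)

lift_definition cl :: "'a::semigroup_mult list \<Rightarrow> 'a igm" is "\<lambda>w. w" .

instantiation igm :: (semigroup_mult) monoid_mult
begin

lift_definition one_igm :: "'a igm" is "[]" .

lift_definition times_igm :: "'a igm \<Rightarrow> 'a igm \<Rightarrow> 'a igm" is "(@)"
  by (meson ig_cong.trans ig_cong_append_left ig_cong_append_right)

instance
  by standard (transfer, simp add: ig_cong.refl)+

end

definition gen :: "'a::semigroup_mult \<Rightarrow> 'a igm" where
  "gen e = cl [e]"

lemma cl_append [simp]: "cl (u @ v) = cl u * cl v"
  by transfer (rule ig_cong.refl)

lemma cl_Nil [simp]: "cl [] = 1"
  by transfer (rule ig_cong.refl)

lemma cl_Cons [simp]: "cl (x # xs) = gen x * cl xs"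
  using cl_append[of "[x]" xs] by (simp add: gen_def)

lemma cl_eq_iff: "cl u = cl v \<longleftrightarrow> ig_cong u v"
  by transfer simp

lemma cl_surj: "\<exists>w. x = cl w"
  by transfer (auto intro: ig_cong.refl)

lemma gen_mult: "basic_pair e f \<Longrightarrow> gen e * gen f = gen (e * f)"
  using ig_cong.step[of e f "[]" "[]"] by (simp flip: cl_eq_iff)

lemma gen_idem: "e \<in> idems \<Longrightarrow> gen e * gen e = gen e"
  using gen_mult[of e e] by (simp add: basic_pairI idems_def)

lemma gen_idem_left: "e \<in> idems \<Longrightarrow> gen e * (gen e * x) = gen e * x"
  by (simp add: gen_idem flip: mult.assoc)

lemma gen_mult_eq:
  assumes "e \<in> idems" "f \<in> idems" "e * f = x"
    and "f * e = e \<or> e * f = e \<or> e * f = f \<or> f * e = f"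
  shows "gen e * gen f = gen x"
  using gen_mult[OF basic_pairI] assms by metis

section \<open>Agreement with the congruence of IG(E) on words over E\<close>

lemma ig_cong_idems: "ig_cong u v \<Longrightarrow> set u \<subseteq> idems \<longleftrightarrow> set v \<subseteq> idems"
  by (induction rule: ig_cong.induct) (auto dest: basic_pair_idems)

lemma ig_cong_Nil: "ig_cong u v \<Longrightarrow> u = [] \<longleftrightarrow> v = []"
  by (induction rule: ig_cong.induct) auto

lemma ig_cong_words: "ig_cong u v \<Longrightarrow> u \<in> words \<longleftrightarrow> v \<in> words"
  using ig_cong_idems[of u v] ig_cong_Nil[of u v] by (simp add: words_def)

lemma eqIG_of_ig_cong: "ig_cong u v \<Longrightarrow> u \<in> words \<Longrightarrow> eqIG u v"
proof (induction rule: ig_cong.induct)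
  case (step e f p q)
  then have "set p \<subseteq> idems" "set q \<subseteq> idems" by (auto simp: words_def)
  then show ?case using step by (intro cong_gen.step ig_rel.basic)
next
  case (refl w)
  then show ?case by (rule cong_gen.refl)
next
  case (sym u v)
  then show ?case using ig_cong_words cong_gen.sym by blast
next
  case (trans u v w)
  then show ?case using ig_cong_words cong_gen.trans by blast
qed

lemma ig_cong_of_eqIG: "eqIG u v \<Longrightarrow> ig_cong u v"
proof (induction rule: cong_gen.induct)
  case (step u v p q)
  then show ?case by (elim ig_relE) (simp add: ig_cong.step[simplified])
qed (auto intro: ig_cong.intros)

lemma eqIG_words: "eqIG u v \<Longrightarrow> u \<in> words \<and> v \<in> words"
proof (induction rule: cong_gen.induct)
  case (step u v p q)
  from step(1) obtain e f where "basic_pair e f" "u = [e, f]" "v = [e * f]"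
    by (rule ig_relE)
  then show ?case using step basic_pair_idems[of e f] by (auto simp: words_def)
qed auto

lemma eqIG_iff: "eqIG u v \<longleftrightarrow> u \<in> words \<and> cl u = cl v"
  using eqIG_words eqIG_of_ig_cong ig_cong_of_eqIG unfolding cl_eq_iff by blast

lemma cl_words: "cl u = cl v \<Longrightarrow> u \<in> words \<longleftrightarrow> v \<in> words"
  unfolding cl_eq_iff by (rule ig_cong_words)

text \<open>S need not have an identity, so the empty word gets an arbitrary value and
  \<open>ev\<close> is multiplicative only on nonempty words. Compatibility with \<open>cl\<close>
  needs no side condition, because the empty word is congruent only to itself.\<close>

fun ev :: "'a::semigroup_mult list \<Rightarrow> 'a" where
  "ev [] = undefined"
| "ev [x] = x"
| "ev (x # y # ys) = x * ev (y # ys)"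

lemma ev_Cons: "v \<noteq> [] \<Longrightarrow> ev (x # v) = x * ev v"
  by (cases v) auto

lemma ev_append: "u \<noteq> [] \<Longrightarrow> v \<noteq> [] \<Longrightarrow> ev (u @ v) = ev u * ev v"
  by (induction u rule: ev.induct) (auto simp: ev_Cons mult.assoc)

lemma ev_replace:
  assumes "ev u = ev v" "u \<noteq> []" "v \<noteq> []"
  shows "ev (p @ u @ q) = ev (p @ v @ q)"
  using assms by (cases "p = []"; cases "q = []") (auto simp: ev_append)

lemma ev_cl: "cl u = cl v \<Longrightarrow> ev u = ev v"
  unfolding cl_eq_iff
proof (induction rule: ig_cong.induct)
  case (step e f p q)
  show ?case by (rule ev_replace) auto
qed auto

lemma ev_mult_cl: "cl (u @ v) = cl w \<Longrightarrow> u \<noteq> [] \<Longrightarrow> v \<noteq> [] \<Longrightarrow> ev u * ev v = ev w"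
  using ev_cl ev_append by metis

lemma ev_eqRIG: "eqRIG u v \<Longrightarrow> ev u = ev v"
proof (induction rule: cong_gen.induct)
  case (step u v p q)
  have "ev u = ev v \<and> u \<noteq> [] \<and> v \<noteq> []"
    using step(1)
  proof cases
    case ig
    then show ?thesis by (elim ig_relE) auto
  next
    case (sw e f h)
    then show ?thesis by (auto simp: sandwich_def mult.assoc)
  qed
  then show ?case by (intro ev_replace) auto
qed auto

section \<open>Idempotents of IG(E) are letters\<close>

text \<open>In terms of Green's relations, \<open>l * m\<close> is L-related to \<open>m\<close> and
  \<open>m * r\<close> is R-related to \<open>m\<close>; hence \<open>m\<close> lies in the D-class
  of \<open>l * m * r\<close>.\<close>

definition anchored :: "'b::monoid_mult \<Rightarrow> 'b \<Rightarrow> 'b \<Rightarrow> bool" where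
  "anchored l m r \<longleftrightarrow> (\<exists>z. z * (l * m) = m) \<and> (\<exists>z. (m * r) * z = m)"

text \<open>In the R-order \<open>m'\<close> is squeezed between \<open>m\<close> and
  \<open>m * r\<close>, so it is R-related to \<open>m\<close>; the left multiplier is not affected
  by the right factor \<open>t\<close>.\<close>

lemma anchored_right_move:
  assumes "anchored l m r" "m' = m * t" "m' * r' = m * r"
  shows "anchored l m' r'"
proof -
  from assms(1) obtain z z' where "z * (l * m) = m" "(m * r) * z' = m"
    by (auto simp: anchored_def)
  then have "z * (l * m') = m'" "(m' * r') * (z' * t) = m'"
    using assms(2,3) by (metis mult.assoc)+
  then show ?thesis by (auto simp: anchored_def)
qed

lemma anchored_left_move:
  assumes "anchored l m r" "m' = t * m" "l' * m' = l * m"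
  shows "anchored l' m' r"
proof -
  from assms(1) obtain z z' where "z * (l * m) = m" "(m * r) * z' = m"
    by (auto simp: anchored_def)
  then have "(t * z) * (l' * m') = m'" "(m' * r) * z' = m'"
    using assms(2,3) by (metis mult.assoc)+
  then show ?thesis by (auto simp: anchored_def)
qed

definition meets_letter :: "'a::semigroup_mult igm \<Rightarrow> bool" where
  "meets_letter u \<longleftrightarrow> (\<exists>c\<in>idems. \<exists>l r. u = l * gen c * r \<and> anchored l (gen c) r)"

lemma meets_letterI:
  "c \<in> idems \<Longrightarrow> anchored l (gen c) r \<Longrightarrow> u = l * gen c * r \<Longrightarrow> meets_letter u"
  by (auto simp: meets_letter_def)

text \<open>In \<open>marked n l v\<close> a prefix of \<open>v\<close> is covered by \<open>n\<close> consecutive blocks, \<open>l\<close> being the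
  class of everything to the left. A boundary between blocks is either a gap
  or a letter that belongs to both blocks; the latter is what
  becomes of a gap when the letters on its two sides are multiplied.\<close>

inductive marked :: "nat \<Rightarrow> 'a::semigroup_mult igm \<Rightarrow> 'a list \<Rightarrow> bool" where
  zero: "marked 0 l v"
| gap: "m \<noteq> [] \<Longrightarrow> anchored l (cl m) (cl r) \<Longrightarrow> marked n (l * cl m) r \<Longrightarrow>
    marked (Suc n) l (m @ r)"
| letter: "anchored l (cl x * gen c) (gen c * cl y) \<Longrightarrow> marked n (l * cl x * gen c) (c # y) \<Longrightarrow>
    marked (Suc n) l (x @ c # y)"

lemma marked_gap_eq:
  assumes "m \<noteq> []" "anchored l (cl m) (cl r)" "marked n (l * cl m) r" "v = m @ r"
  shows "marked (Suc n) l v"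
  using assms marked.gap by blast

lemma marked_letter_eq:
  assumes "anchored l (cl x * gen c) (gen c * cl y)" "marked n (l * cl x * gen c) (c # y)"
    "v = x @ c # y"
  shows "marked (Suc n) l v"
  using assms marked.letter by blast

text \<open>Every block uses up at least one letter: a block could fail to do so only by consisting
  of the shared letter alone, and that letter would then be D-related to the whole element.\<close>

lemma marked_bound:
  assumes "marked n l v" "set v \<subseteq> idems" "\<not> meets_letter (l * cl v)"
  shows "n \<le> length v"
  using assms
proof (induction rule: marked.induct)
  case (gap m l r n)
  then have "n \<le> length r" by (simp add: mult.assoc)
  moreover have "length m > 0" using gap by simp
  ultimately show ?case unfolding length_append by linarith
next
  case (letter l x c y n)
  have "x \<noteq> []"
  proof
    assume "x = []"
    then have "meets_letter (l * cl (x @ c # y))"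
      using letter
      by (intro meets_letterI[of c l "gen c * cl y"]) (auto simp: mult.assoc gen_idem_left)
    then show False using letter by simp
  qed
  moreover have "l * cl x * gen c * cl (c # y) = l * cl (x @ c # y)"
    using letter by (simp add: mult.assoc gen_idem_left)
  then have "n \<le> length (c # y)" using letter by simp
  ultimately show ?case by (cases x) auto
qed simp

text \<open>This serves for rewriting at the left end of the remaining word. Only the first block
  changes, by a left factor, and its right boundary stays in place. That boundary cannot be the head
  letter itself, since the element would then meet a letter.\<close>

lemma marked_head_change:
  assumes "marked n l (c # q)" "l' * gen c' = l * gen c" "gen c' = t * gen c"
    and "c \<in> idems" "\<not> meets_letter (l * cl (c # q))"
  shows "marked n l' (c' # q)"
  using assms(1)
proof cases
  case zero
  then show ?thesis by (simp add: marked.zero)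
next
  case (gap m r k)
  then obtain m1 where m: "m = c # m1" "q = m1 @ r" by (cases m) auto
  have eq: "l' * cl (c' # m1) = l * cl m"
    using m assms(2) by (simp add: mult.assoc[symmetric])
  have "anchored l' (cl (c' # m1)) (cl r)"
    using gap(4) by (rule anchored_left_move[of _ _ _ _ t]) (use m eq assms(3) in \<open>simp_all add: mult.assoc\<close>)
  then show ?thesis unfolding gap(1) using m eq gap
    by (intro marked_gap_eq[of "c' # m1" _ r]) auto
next
  case (letter x d y k)
  have "x \<noteq> []"
  proof
    assume "x = []"
    then have "meets_letter (l * cl (c # q))"
      using letter assms(4)
      by (intro meets_letterI[of c l "gen c * cl y"]) (auto simp: mult.assoc gen_idem_left)
    then show False using assms by simp
  qed
  then obtain x1 where m: "x = c # x1" "q = x1 @ d # y" using letter by (cases x) auto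
  have eq: "l' * cl (c' # x1) * gen d = l * cl x * gen d"
    using m assms(2) by (simp add: mult.assoc[symmetric])
  have "anchored l' (cl (c' # x1) * gen d) (gen d * cl y)"
    using letter(3) by (rule anchored_left_move[of _ _ _ _ t]) (use m eq assms(3) in \<open>simp_all add: mult.assoc\<close>)
  then show ?thesis unfolding letter(1) using m eq letter
    by (intro marked_letter_eq[of _ "c' # x1" d y]) auto
qed

lemma append_eq_append_pair:
  assumes "m @ r = p @ [e, f] @ q"
  obtains q1 where "m = p @ [e, f] @ q1" "q = q1 @ r"
  | "m = p @ [e]" "r = f # q"
  | p1 where "p = m @ p1" "r = p1 @ [e, f] @ q"
  using assms by (auto simp: append_eq_append_conv2 append_eq_Cons_conv Cons_eq_append_conv)

lemma append_eq_append_single: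
  assumes "m @ r = p @ [d] @ q"
  obtains q1 where "m = p @ [d] @ q1" "q = q1 @ r"
  | p1 where "p = m @ p1" "r = p1 @ [d] @ q"
  using assms by (auto simp: append_eq_append_conv2 append_eq_Cons_conv Cons_eq_append_conv)

text \<open>A pair that the first boundary does not touch is rewritten inside its block or by
  induction. If the boundary separates \<open>e\<close> and \<open>f\<close>, or is one of them, it
  becomes the letter \<open>e * f\<close>.\<close>

lemma marked_contract:
  assumes "basic_pair e f"
  shows "marked n l (p @ [e, f] @ q) \<Longrightarrow> set (p @ [e, f] @ q) \<subseteq> idems \<Longrightarrow>
    \<not> meets_letter (l * cl (p @ [e, f] @ q)) \<Longrightarrow> marked n l (p @ [e * f] @ q)"
proof (induction n arbitrary: l p)
  case 0
  then show ?case by (simp add: marked.zero)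
next
  case (Suc n)
  have E: "e \<in> idems" "f \<in> idems" "e * f \<in> idems" using assms by (rule basic_pair_idems)+
  have ef: "gen (e * f) = gen e * gen f" using gen_mult[OF assms] by simp
  have ee: "gen e * gen e = gen e" "\<And>x. gen e * (gen e * x) = gen e * x"
    and ff: "gen f * gen f = gen f" "\<And>x. gen f * (gen f * x) = gen f * x"
    and efef: "gen e * (gen f * (gen e * gen f)) = gen e * gen f"
      "\<And>x. gen e * (gen f * (gen e * (gen f * x))) = gen e * (gen f * x)"
    using E gen_idem ef by (metis mult.assoc)+
  note rw = ef ee ff efef mult.assoc
  \<comment> \<open>The common core of the three cases in which the first boundary touches the pair:
    \<open>m\<close> and \<open>r\<close> are the old block and the old remainder, and
    \<open>c # q\<close> is a word on which the other \<open>n\<close> blocks are already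
    known.\<close>
  have zone: "marked (Suc n) l (p @ [e * f] @ q)"
    if "anchored l m r" "cl p * gen (e * f) = m * t"
      "m * r = cl p * gen e * gen f * cl q"
      "marked n l1 (c # q)" "l1 * gen c = l * cl p * gen e * gen f" "gen (e * f) = t' * gen c"
      "c \<in> idems"
    for m r t l1 c t'
  proof (rule marked_letter_eq)
    show "anchored l (cl p * gen (e * f)) (gen (e * f) * cl q)"
      using that(1,2) by (rule anchored_right_move) (use that(3) in \<open>simp add: rw\<close>)
    have "l1 * cl (c # q) = l * cl (p @ [e, f] @ q)"
      using that(5) by (simp add: mult.assoc[symmetric])
    then have "\<not> meets_letter (l1 * cl (c # q))" using Suc.prems by simp
    moreover have "l * cl p * gen (e * f) * gen (e * f) = l1 * gen c"
      unfolding that(5) by (simp add: rw)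
    ultimately show "marked n (l * cl p * gen (e * f)) (e * f # q)"
      using that(6,7) by (intro marked_head_change[OF that(4), of _ _ t'])
  qed simp
  from Suc.prems(1) show ?case
  proof cases
    case (gap m r)
    from gap(1)[symmetric] show ?thesis
    proof (rule append_eq_append_pair)
      fix q1 assume "m = p @ [e, f] @ q1" "q = q1 @ r"
      then show ?thesis using gap
        by (intro marked_gap_eq[of "p @ [e * f] @ q1" _ r]) (auto simp: rw)
    next
      assume *: "m = p @ [e]" "r = f # q"
      show ?thesis using gap * E
        by (intro zone[of "cl m" "cl r" "gen f" "l * cl m" f "gen e"]) (auto simp: rw)
    next
      fix p1 assume *: "p = m @ p1" "r = p1 @ [e, f] @ q"
      have "marked n (l * cl m) (p1 @ [e * f] @ q)"
        using Suc.prems gap * by (intro Suc.IH) (auto simp: mult.assoc)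
      then show ?thesis using gap *
        by (intro marked_gap_eq[of m _ "p1 @ [e * f] @ q"]) (auto simp: rw)
    qed
  next
    case (letter x c y)
    have "c \<in> set (p @ [e, f] @ q)" unfolding letter(1) by simp
    then have "c \<in> idems" using Suc.prems(2) by blast
    then have cc: "gen c * gen c = gen c" "\<And>x. gen c * (gen c * x) = gen c * x"
      using gen_idem[of c] by (auto simp: mult.assoc[symmetric])
    from letter(1)[symmetric] show ?thesis
    proof (rule append_eq_append_pair)
      fix q1 assume "x = p @ [e, f] @ q1" "q = q1 @ c # y"
      then show ?thesis using letter
        by (intro marked_letter_eq[of _ "p @ [e * f] @ q1" c y]) (auto simp: rw)
    next
      assume *: "x = p @ [e]" "c # y = f # q"
      show ?thesis using letter * E
        by (intro zone[of "cl x * gen c" "gen c * cl y" 1 "l * cl x * gen c" f "gen e"])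
           (auto simp: rw)
    next
      fix p1 assume *: "p = x @ p1" "c # y = p1 @ [e, f] @ q"
      have total: "l * cl x * gen c * cl (c # y) = l * cl (p @ [e, f] @ q)"
        unfolding letter(1) by (simp add: mult.assoc cc)
      have IH: "marked n (l * cl x * gen c) (p1 @ [e * f] @ q)"
        using Suc.prems letter * total by (intro Suc.IH) (auto simp: mult.assoc)
      show ?thesis
      proof (cases p1)
        case Nil
        then have "c = e" "y = f # q" "p = x" using * by auto
        then show ?thesis using letter IH Nil E
          by (intro zone[of "cl x * gen c" "gen c * cl y" "gen f" "l * cl x * gen c" "e * f" 1])
             (auto simp: rw)
      next
        case (Cons c' p2)
        then have "c' = c" "y = p2 @ [e, f] @ q" using * by auto
        then show ?thesis using letter IH Cons *
          by (intro marked_letter_eq[of _ x c "p2 @ [e * f] @ q"]) (auto simp: rw)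
      qed
    qed
  qed
qed

text \<open>The critical case is a boundary at the letter \<open>e * f\<close> itself. By
  \<open>rel\<close> this letter is R-related to \<open>e\<close> or L-related to \<open>f\<close>;
  the boundary moves to \<open>e\<close> in the first case and to \<open>f\<close> in the
  second.\<close>

lemma marked_expand:
  assumes "basic_pair e f"
  shows "marked n l (p @ [e * f] @ q) \<Longrightarrow> set (p @ [e * f] @ q) \<subseteq> idems \<Longrightarrow>
    \<not> meets_letter (l * cl (p @ [e * f] @ q)) \<Longrightarrow> marked n l (p @ [e, f] @ q)"
proof (induction n arbitrary: l p)
  case 0
  then show ?case by (simp add: marked.zero)
next
  case (Suc n)
  have E: "e \<in> idems" "f \<in> idems" "e * f \<in> idems" using assms by (rule basic_pair_idems)+
  have ef: "gen (e * f) = gen e * gen f" using gen_mult[OF assms] by simp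
  have ee: "gen e * gen e = gen e" "\<And>x. gen e * (gen e * x) = gen e * x"
    and ff: "gen f * gen f = gen f" "\<And>x. gen f * (gen f * x) = gen f * x"
    and efef: "gen e * (gen f * (gen e * gen f)) = gen e * gen f"
      "\<And>x. gen e * (gen f * (gen e * (gen f * x))) = gen e * (gen f * x)"
    using E gen_idem ef by (metis mult.assoc)+
  note rw = ef ee ff efef mult.assoc
  have rel: "gen e * (gen f * gen e) = gen e \<or> gen f * (gen e * gen f) = gen f"
  proof -
    have fe: "gen f * gen e = gen (f * e)"
      using assms by (intro gen_mult) (auto simp: basic_pair_def)
    from assms consider "f * e = e" | "e * f = e" | "e * f = f" | "f * e = f"
      by (auto simp: basic_pair_def omega_r_def omega_l_def)
    then show ?thesis using ef fe ee ff by cases (metis mult.assoc)+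
  qed
  from Suc.prems(1) show ?case
  proof cases
    case (gap m r)
    from gap(1)[symmetric] show ?thesis
    proof (rule append_eq_append_single)
      fix q1 assume "m = p @ [e * f] @ q1" "q = q1 @ r"
      then show ?thesis using gap
        by (intro marked_gap_eq[of "p @ [e, f] @ q1" _ r]) (auto simp: rw)
    next
      fix p1 assume *: "p = m @ p1" "r = p1 @ [e * f] @ q"
      have "marked n (l * cl m) (p1 @ [e, f] @ q)"
        using Suc.prems gap * by (intro Suc.IH) (auto simp: mult.assoc)
      then show ?thesis using gap *
        by (intro marked_gap_eq[of m _ "p1 @ [e, f] @ q"]) (auto simp: rw)
    qed
  next
    case (letter x c y)
    have "c \<in> set (p @ [e * f] @ q)" unfolding letter(1) by simp
    then have "c \<in> idems" using Suc.prems(2) by blast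
    then have cc: "gen c * gen c = gen c" "\<And>x. gen c * (gen c * x) = gen c * x"
      using gen_idem[of c] by (auto simp: mult.assoc[symmetric])
    from letter(1)[symmetric] show ?thesis
    proof (rule append_eq_append_single)
      fix q1 assume "x = p @ [e * f] @ q1" "q = q1 @ c # y"
      then show ?thesis using letter
        by (intro marked_letter_eq[of _ "p @ [e, f] @ q1" c y]) (auto simp: rw)
    next
      fix p1 assume *: "p = x @ p1" "c # y = p1 @ [e * f] @ q"
      have total: "l * cl x * gen c * cl (c # y) = l * cl (p @ [e * f] @ q)"
        unfolding letter(1) by (simp add: mult.assoc cc)
      have IH: "marked n (l * cl x * gen c) (p1 @ [e, f] @ q)"
        using Suc.prems letter * total by (intro Suc.IH) (auto simp: mult.assoc)
      show ?thesis
      proof (cases p1)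
        case Nil
        then have c: "c = e * f" "y = q" "p = x" using * by auto
        have no: "\<not> meets_letter (l * (cl p * (gen e * (gen f * cl q))))"
          using Suc.prems(3) by (simp add: rw)
        from rel show ?thesis
        proof
          assume efe: "gen e * (gen f * gen e) = gen e"
          then have efe': "gen e * (gen f * (gen e * x)) = gen e * x" for x
            by (metis mult.assoc)
          have m: "marked n (l * cl x * gen c) (e # f # q)" using IH Nil by simp
          have eq: "l * cl p * gen e * gen e = l * cl x * gen c * gen e"
            by (simp add: rw c efe)
          have tot: "l * cl x * gen c * cl (e # f # q) = l * cl (p @ [e, f] @ q)"
            by (simp add: rw c)
          have "\<not> meets_letter (l * cl x * gen c * cl (e # f # q))"
            unfolding tot using no by simp
          then have 1: "marked n (l * cl p * gen e) (e # f # q)"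
            by (intro marked_head_change[OF m eq, of 1] E) simp
          have 2: "anchored l (cl p * gen e) (gen e * cl (f # q))"
            using letter(2)
            by (rule anchored_right_move[of _ _ _ _ "gen e"]) (simp_all add: rw c efe efe')
          show ?thesis by (rule marked_letter_eq[OF 2 1]) simp
        next
          assume fef: "gen f * (gen e * gen f) = gen f"
          have m: "marked n (l * cl x * gen c) (c # q)" using letter c by simp
          have eq: "l * cl (p @ [e]) * gen f * gen f = l * cl x * gen c * gen c"
            by (simp add: rw c)
          have tot: "l * cl x * gen c * cl (c # q) = l * cl (p @ [e, f] @ q)"
            by (simp add: rw c)
          have "\<not> meets_letter (l * cl x * gen c * cl (c # q))"
            unfolding tot using no by simp
          moreover have "gen f = gen f * gen c" by (simp add: rw c fef)
          ultimately have 1: "marked n (l * cl (p @ [e]) * gen f) (f # q)"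
            by (intro marked_head_change[OF m eq] \<open>c \<in> idems\<close>)
          have 2: "anchored l (cl (p @ [e]) * gen f) (gen f * cl q)"
            using letter(2)
            by (rule anchored_right_move[of _ _ _ _ 1]) (simp_all add: rw c)
          show ?thesis by (rule marked_letter_eq[OF 2 1]) simp
        qed
      next
        case (Cons c' p2)
        then have "c' = c" "y = p2 @ [e * f] @ q" using * by auto
        then show ?thesis using letter IH Cons *
          by (intro marked_letter_eq[of _ x c "p2 @ [e, f] @ q"]) (auto simp: rw)
      qed
    qed
  qed
qed

lemma marked_cong:
  assumes "ig_cong v w" "set v \<subseteq> idems" "\<not> meets_letter (l * cl v)"
  shows "marked n l v \<longleftrightarrow> marked n l w"
  using assms
proof (induction rule: ig_cong.induct)
  case (step e f p q)
  have "cl (p @ [e, f] @ q) = cl (p @ [e * f] @ q)"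
    using step ig_cong.step cl_eq_iff by blast
  moreover have "set (p @ [e * f] @ q) \<subseteq> idems"
    using step basic_pair_idems(3)[of e f] by auto
  ultimately show ?case
    using step marked_contract[of e f n l p q] marked_expand[of e f n l p q] by metis
next
  case (sym u v)
  then show ?case using ig_cong_idems cl_eq_iff by metis
next
  case (trans u v w)
  then show ?case using ig_cong_idems cl_eq_iff by metis
qed simp

lemma idempotent_meets_letter:
  assumes v: "v \<in> words" and idem: "cl v * cl v = cl v"
  shows "meets_letter (cl v)"
proof (rule ccontr)
  assume no: "\<not> meets_letter (cl v)"
  define pow where "pow n = concat (replicate n v)" for n
  have cl_pow: "cl (pow (Suc n)) = cl v" for n
    by (induction n) (auto simp: pow_def idem)
  have "marked n (cl v) (pow (Suc n))" for n
  proof (induction n)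
    case (Suc n)
    \<comment> \<open>Each block is one copy of \<open>v\<close>, and idempotency keeps the class on
      the left equal to \<open>cl v\<close>. One copy more than the number of blocks is used, so
      that the power is never empty and its class is always \<open>cl v\<close>.\<close>
    have "anchored (cl v) (cl v) (cl (pow (Suc n)))"
      unfolding anchored_def cl_pow by (auto simp: idem intro!: exI[of _ 1])
    then show ?case using Suc v idem
      by (intro marked_gap_eq[of v _ "pow (Suc n)"]) (auto simp: pow_def words_def)
  qed (rule marked.zero)
  moreover have "set (pow (Suc n)) \<subseteq> idems" for n
    using v by (auto simp: pow_def words_def)
  ultimately have "marked (Suc (length v)) (cl v) v"
    using marked_cong[of "pow (Suc (Suc (length v)))" v "cl v"] cl_pow no idem
    unfolding cl_eq_iff[symmetric] by auto
  then have "Suc (length v) \<le> length v"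
    using marked_bound no idem v by (metis words_def mem_Collect_eq)
  then show False by simp
qed

section \<open>Regular elements of IG(E) act by sandwich products\<close>

lemma left_assoc_eq: "a * b = c \<Longrightarrow> a * (b * w) = c * (w::'b::semigroup_mult)"
  by (simp flip: mult.assoc)

lemma left_assoc_eq3: "a * (b * c) = d \<Longrightarrow> a * (b * (c * w)) = d * (w::'b::semigroup_mult)"
  by (simp flip: mult.assoc)

text \<open>Green's relation L between \<open>p\<close> and the letter \<open>f\<close>.\<close>

definition lrel :: "'a::semigroup_mult igm \<Rightarrow> 'a \<Rightarrow> bool" where
  "lrel p f \<longleftrightarrow> p * gen f = p \<and> (\<exists>z. z * p = gen f)"

text \<open>Meaningful only if \<open>p\<close> is L-related to some letter; the choice of \<open>f\<close> and \<open>h\<close> is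
  then immaterial.\<close>

definition opr :: "'a::semigroup_mult igm \<Rightarrow> 'a \<Rightarrow> 'a igm" where
  "opr p e = (SOME q. \<exists>f\<in>idems. \<exists>h\<in>sandwich f e. lrel p f \<and> q = p * gen h * gen e)"

section \<open>Sandwich sets and their products in IG(E)\<close>

lemma sandwichD:
  assumes "h \<in> sandwich f e" "f \<in> idems" "e \<in> idems"
  shows "h \<in> idems" "h * h = h" "h * f = h" "e * h = h" "f * (h * e) = f * e"
    and "f * f = f" "e * e = e"
proof -
  have h: "f * h * e = f * e" "e * h * f = h" "h \<in> idems" and "f * f = f" "e * e = e"
    using assms by (auto simp: sandwich_def idems_def)
  then show "h \<in> idems" "h * h = h" "h * f = h" "e * h = h" "f * (h * e) = f * e"
    "f * f = f" "e * e = e"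
    by (auto simp: idems_def mult.assoc) (metis mult.assoc)+
qed

lemma sandwichI:
  assumes "h * h = h" "h * f = h" "e * h = h" "f * (h * e) = f * e"
  shows "h \<in> sandwich f e"
  using assms by (auto simp: sandwich_def idems_def mult.assoc)

lemma sandwich_nonempty:
  fixes f e :: "'a::semigroup_mult"
  assumes reg: "\<forall>x::'a. \<exists>y. x * y * x = x" and "f \<in> idems" "e \<in> idems"
  obtains h where "h \<in> sandwich f e"
proof -
  have ff: "f * f = f" and ee: "e * e = e" using assms by (auto simp: idems_def)
  obtain y where y: "f * e * y * (f * e) = f * e" using reg by blast
  \<comment> \<open>\<open>x\<close> is an inverse of \<open>f * e\<close>: besides the equation for
    \<open>y\<close> it satisfies \<open>x * (f * e) * x = x\<close>. The sandwich element is then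
    \<open>e * x * f\<close>.\<close>
  define x where "x = y * (f * e) * y"
  have 1: "f * (e * (x * (f * e))) = f * e" and 2: "x * (f * (e * x)) = x"
    unfolding x_def using y by (metis mult.assoc)+
  have ext: "x * (f * (e * (x * w))) = x * w" for w
    using 2 by (metis mult.assoc)
  have "e * (x * f) \<in> sandwich f e"
    using 1 by (intro sandwichI)
      (simp_all add: mult.assoc left_assoc_eq[OF ff] left_assoc_eq[OF ee] ext ff)
  then show ?thesis by (rule that)
qed

lemma gen_sandwich_left:
  assumes "h \<in> sandwich f e" "f \<in> idems" "e \<in> idems"
  shows "gen f * gen h = gen (f * h)" "gen h * gen f = gen h"
  using sandwichD[OF assms] assms by (auto intro!: gen_mult_eq)

lemma gen_sandwich_right:
  assumes "h \<in> sandwich f e" "f \<in> idems" "e \<in> idems"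
  shows "gen h * gen e = gen (h * e)" "gen e * gen h = gen h"
  using sandwichD[OF assms] assms by (auto intro!: gen_mult_eq)

lemma sandwich_mult_idems:
  assumes "h \<in> sandwich f e" "f \<in> idems" "e \<in> idems"
  shows "h * e \<in> idems"
  using basic_pair_idems(3)[OF basic_pairI] sandwichD[OF assms] assms by metis

text \<open>The element \<open>k = h * h'\<close> satisfies \<open>k * e = h * e\<close> and
  \<open>f * k = f * h'\<close>, and both products are basic. IG(E) can therefore pass from
  \<open>h\<close> to \<open>h'\<close> through \<open>k\<close>.\<close>

lemma gen_sandwich_unique:
  assumes h: "h \<in> sandwich f e" and h': "h' \<in> sandwich f e" and E: "f \<in> idems" "e \<in> idems"
  shows "gen f * gen h * gen e = gen f * gen h' * gen e"
proof -
  note H = sandwichD[OF h E] and H' = sandwichD[OF h' E]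
  define k where "k = h * h'"
  have fe: "h * (h' * e) = h * e" "f * (h * h') = f * h'" "h * (h' * h) = h"
    using H H' by (metis mult.assoc)+
  have "k \<in> idems" unfolding k_def idems_def using fe(3) 
    by (simp add: mult.assoc left_assoc_eq3[OF fe(3)])
  moreover have "k * f = k" "e * k = k" unfolding k_def using H H' by (metis mult.assoc)+
  ultimately have 1: "gen k * gen e = gen (h * e)" and 2: "gen f * gen k = gen (f * h')"
    using E fe by (auto intro!: gen_mult_eq simp: k_def mult.assoc)
  have "gen f * gen h * gen e = gen f * (gen k * gen e)"
    using 1 gen_sandwich_right[OF h E] by (simp add: mult.assoc)
  also have "\<dots> = gen f * gen h' * gen e"
    using 2 gen_sandwich_left[OF h' E] by (simp flip: mult.assoc)
  finally show ?thesis .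
qed

lemma lrel_unique:
  assumes "lrel p f" "lrel p f'" "f \<in> idems" "f' \<in> idems"
  shows "f * f' = f"
proof -
  obtain z where "z * p = gen f" using assms by (auto simp: lrel_def)
  then have "cl [f, f'] = cl [f]" using assms(2) by (simp add: lrel_def) (metis mult.assoc)
  then show ?thesis using ev_cl by fastforce
qed

text \<open>Two letters L-related to \<open>p\<close> are L-related to each other in S and so have
  the same sandwich set with \<open>e\<close>. Since \<open>p\<close> absorbs \<open>f\<close> on
  the right, \<open>gen_sandwich_unique\<close> applies behind \<open>p\<close>.\<close>

lemma opr_eq:
  assumes p: "lrel p f" and h: "h \<in> sandwich f e" and E: "f \<in> idems" "e \<in> idems"
  shows "opr p e = p * gen h * gen e"
proof -
  have "\<exists>q. \<exists>f\<in>idems. \<exists>h\<in>sandwich f e. lrel p f \<and> q = p * gen h * gen e"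
    using assms by blast
  from someI_ex[OF this] obtain f' h' where
    f': "f' \<in> idems" "h' \<in> sandwich f' e" "lrel p f'" "opr p e = p * gen h' * gen e"
    unfolding opr_def by blast
  have ff: "f * f' = f" "f' * f = f'" using lrel_unique p f' E by blast+
  have "h' \<in> sandwich f e"
    using sandwichD[OF f'(2,1) E(2)] ff by (intro sandwichI) (metis mult.assoc)+
  then have eq: "gen f * gen h * gen e = gen f * gen h' * gen e"
    using gen_sandwich_unique h E by blast
  have "p * gen h * gen e = p * (gen f * gen h * gen e)"
    using p by (simp add: lrel_def flip: mult.assoc)
  also have "\<dots> = p * gen h' * gen e"
    unfolding eq using p by (simp add: lrel_def flip: mult.assoc)
  finally show ?thesis using f' by simp
qed

text \<open>The result is again L-related to a letter, so the sandwich products can be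
  iterated.\<close>

lemma lrel_sandwich:
  assumes p: "lrel p f" and h: "h \<in> sandwich f e" and E: "f \<in> idems" "e \<in> idems"
  shows "lrel (p * gen h * gen e) (h * e)"
proof -
  obtain z where z: "z * p = gen f" using p by (auto simp: lrel_def)
  have he: "gen h * gen e = gen (h * e)" and hf: "gen h * gen f = gen h"
    using gen_sandwich_left[OF h E] gen_sandwich_right[OF h E] by auto
  have "gen (h * e) * gen (h * e) = gen (h * e)"
    using sandwich_mult_idems[OF h E] by (rule gen_idem)
  moreover have "gen h * gen h = gen h" using sandwichD(1)[OF h E] by (rule gen_idem)
  ultimately show ?thesis unfolding lrel_def using z he hf
    by (intro conjI exI[of _ "gen h * z"]) (metis mult.assoc)+
qed

lemma opr_lrel:
  fixes e :: "'a::semigroup_mult"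
  assumes reg: "\<forall>x::'a. \<exists>y. x * y * x = x" and "lrel p f" "f \<in> idems" "e \<in> idems"
  obtains h where "h \<in> sandwich f e" "opr p e = p * gen h * gen e"
    "lrel (opr p e) (h * e)" "h * e \<in> idems"
proof -
  obtain h where "h \<in> sandwich f e" using sandwich_nonempty reg assms by blast
  then show ?thesis using that opr_eq lrel_sandwich sandwich_mult_idems assms by metis
qed

text \<open>If \<open>h1\<close> and \<open>h2\<close> are the sandwich elements of the two steps,
  \<open>h2 * h1\<close> is a sandwich element for the single step.\<close>

lemma opr_omega_r:
  fixes e f :: "'a::semigroup_mult"
  assumes reg: "\<forall>x::'a. \<exists>y. x * y * x = x"
    and p: "lrel p a" and E: "a \<in> idems" "e \<in> idems" "f \<in> idems" and ef: "e * f = f"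
  shows "opr (opr p e) f = opr p f"
proof -
  obtain h1 where h1: "h1 \<in> sandwich a e" "opr p e = p * gen h1 * gen e"
    "lrel (opr p e) (h1 * e)" "h1 * e \<in> idems"
    using opr_lrel[OF reg p E(1,2)] .
  obtain h2 where h2: "h2 \<in> sandwich (h1 * e) f"
    "opr (opr p e) f = opr p e * gen h2 * gen f"
    using opr_lrel[OF reg h1(3,4) E(3)] .
  note H1 = sandwichD[OF h1(1) E(1,2)] and H2 = sandwichD[OF h2(1) h1(4) E(3)]
  have eh2: "e * h2 = h2" using H2(4) ef by (metis mult.assoc)
  have h2h1e: "h2 * (h1 * e) = h2" by (rule H2(3))
  have h212: "h2 * (h1 * h2) = h2" using h2h1e eh2 H2(2) by (metis mult.assoc)
  have h1f: "h1 * f = h1 * (h2 * f)" using H2(5) ef eh2 by (metis mult.assoc)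
  have ah2: "a * (h1 * h2) = a * h2" using H1(5) eh2 by (metis mult.assoc)
  \<comment> \<open>Since \<open>d * a = d\<close> and \<open>e * d = d\<close>, the products of
    \<open>a\<close> with \<open>d\<close> and of \<open>d\<close> with \<open>e\<close> are basic.
    Through \<open>d * e = h1 * h2\<close> and \<open>a * d = a * k\<close> they connect the two
    steps with \<open>k\<close>.\<close>
  define d where "d = h1 * (h2 * h1)"
  define k where "k = h2 * h1"
  have af: "a * f = a * (h2 * f)" using ah2 h1f H1(5) ef by (metis mult.assoc)
  have kS: "k \<in> sandwich a f"
  proof (rule sandwichI)
    show "k * k = k" "k * a = k" "f * k = k"
      unfolding k_def using h212 H1 H2 by (metis mult.assoc)+
    show "a * (k * f) = a * f"
      unfolding k_def using af h1f h212 by (metis mult.assoc)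
  qed
  have dI: "d \<in> idems" unfolding d_def idems_def mem_Collect_eq
    using h212 H1(2) by (metis mult.assoc)
  have ed: "e * d = d" and da: "d * a = d" and de: "d * e = h1 * h2" and ad: "a * d = a * k"
    unfolding d_def k_def using H1 h2h1e ah2 by (metis mult.assoc)+
  have kI: "k \<in> idems" "k * a = k" using sandwichD[OF kS E(1,3)] by auto
  have c: "gen (h1 * e) * gen h2 = gen (h1 * h2)"
    using h1(4) H2(1) h2h1e eh2 by (intro gen_mult_eq) (auto simp: mult.assoc)
  have de': "gen d * gen e = gen (h1 * h2)" using dI E ed de by (intro gen_mult_eq) auto
  have ef': "gen e * gen f = gen f" using E ef by (intro gen_mult_eq) auto
  have ad': "gen a * gen d = gen a * gen k"
    using gen_mult_eq[OF E(1) dI ad] gen_mult_eq[OF E(1) kI(1) HOL.refl] da kI(2) by simp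
  have pa: "p * gen a = p" using p by (simp add: lrel_def)
  have "opr (opr p e) f = p * (gen (h1 * e) * gen h2) * gen f"
    using h2(2) h1(2) gen_sandwich_right[OF h1(1) E(1,2)] by (simp add: mult.assoc)
  also have "\<dots> = p * gen d * (gen e * gen f)"
    unfolding c de'[symmetric] by (simp add: mult.assoc)
  also have "\<dots> = p * (gen a * gen d) * gen f"
    unfolding ef' mult.assoc[symmetric] pa ..
  also have "\<dots> = p * gen k * gen f"
    unfolding ad' mult.assoc[symmetric] pa ..
  also have "\<dots> = opr p f" using opr_eq[OF p kS E(1,3)] by simp
  finally show ?thesis .
qed

lemma opr_basic:
  fixes e f :: "'a::semigroup_mult"
  assumes reg: "\<forall>x::'a. \<exists>y. x * y * x = x"
    and p: "lrel p a" and a: "a \<in> idems" and bas: "basic_pair e f"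
  shows "opr (opr p e) f = opr p (e * f)"
proof -
  have E: "e \<in> idems" "f \<in> idems" "e * f \<in> idems" using bas by (rule basic_pair_idems)+
  have ef: "gen (e * f) = gen e * gen f" using gen_mult[OF bas] by simp
  define q where "q = opr p e"
  obtain h1 where h1: "h1 \<in> sandwich a e" and q: "q = p * gen h1 * gen e"
    and qb: "lrel q (h1 * e)" and bI: "h1 * e \<in> idems"
    unfolding q_def using opr_lrel[OF reg p a E(1)] .
  define b where "b = h1 * e"
  note H1 = sandwichD[OF h1 a E(1)]
  have bb: "b * b = b" and be: "b * e = b" and b: "b \<in> idems" "lrel q b"
    using bI qb H1(7) by (auto simp: b_def idems_def mult.assoc)
  have qgb: "q * gen b = q" using b by (simp add: lrel_def)
  from bas consider "f * e = e" | "e * f = e" | "e * f = f" | "f * e = f"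
    by (auto simp: basic_pair_def omega_r_def omega_l_def)
  then show ?thesis
  proof cases
    case 1
    \<comment> \<open>Here \<open>e\<close> and \<open>e * f\<close> are R-related, so
      \<open>h1\<close> serves for both; in the second step \<open>b\<close> is its own sandwich
      element.\<close>
    have "h1 \<in> sandwich a (e * f)"
      using H1 1 by (intro sandwichI) (metis mult.assoc)+
    then have "opr p (e * f) = q * gen f"
      using opr_eq[OF p _ a E(3)] by (simp add: q ef mult.assoc)
    moreover have "f * b = b" unfolding b_def using 1 H1(4) by (metis mult.assoc)
    then have "b \<in> sandwich b f"
      using bb by (intro sandwichI) (simp_all flip: mult.assoc)
    then have "opr q f = q * gen b * gen f" using opr_eq b E by blast
    ultimately show ?thesis using qgb by (simp add: q_def)
  next
    case 2
    \<comment> \<open>Here \<open>f\<close> fixes \<open>b\<close> on the right, so the second step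
      leaves \<open>q\<close> unchanged.\<close>
    have bf: "b * f = b" unfolding b_def using 2 by (simp add: mult.assoc)
    have ff: "f * f = f" using E by (simp add: idems_def)
    have S: "f * b \<in> sandwich b f"
      using bb bf ff by (intro sandwichI) (metis mult.assoc)+
    have "gen b * gen (f * b) = gen b"
      using b sandwichD(1)[OF S b(1) E(2)] bb bf
      by (intro gen_mult_eq) (auto simp flip: mult.assoc)
    moreover have "gen b * gen f = gen b" using b E bf by (intro gen_mult_eq) auto
    moreover have "opr q f = q * gen (f * b) * gen f" using opr_eq S b E by blast
    ultimately have "opr q f = q" using qgb by (metis mult.assoc)
    then show ?thesis by (simp add: q_def 2)
  next
    case 3
    then show ?thesis using opr_omega_r[OF reg p a E(1,2)] by simp
  next
    case 4
    \<comment> \<open>Here \<open>f\<close> and \<open>e * f\<close> are L-related. As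
      \<open>q\<close> absorbs \<open>e\<close>, replacing \<open>h2\<close> by
      \<open>e * h2\<close> turns the action of \<open>f\<close> into that of \<open>e * f\<close>,
      and \<open>opr_omega_r\<close> applies to \<open>e\<close> and \<open>e * f\<close>.\<close>
    obtain h2 where h2: "h2 \<in> sandwich b f" "opr q f = q * gen h2 * gen f"
      using opr_lrel[OF reg b(2,1) E(2)] .
    note H2 = sandwichD[OF h2(1) b(1) E(2)]
    have h2e: "h2 * e = h2" using H2(3) be by (metis mult.assoc)
    have "e * h2 \<in> sandwich b (e * f)"
    proof (rule sandwichI)
      show "e * h2 * (e * h2) = e * h2" "e * h2 * b = e * h2"
        using h2e H2 by (metis mult.assoc)+
      show "e * f * (e * h2) = e * h2" using 4 H2(4) by (metis mult.assoc)
      show "b * (e * h2 * (e * f)) = b * (e * f)" using be h2e H2(5) by (metis mult.assoc)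
    qed
    then have "opr q (e * f) = q * gen (e * h2) * gen (e * f)"
      using opr_eq b E by blast
    also have "gen (e * h2) = gen e * gen h2"
      using E H2(1) h2e by (intro gen_mult_eq[symmetric]) auto
    also have "q * (gen e * gen h2) * gen (e * f) = (q * gen e) * (gen h2 * gen e) * gen f"
      by (simp add: ef mult.assoc)
    also have "gen h2 * gen e = gen h2" using E H2(1) h2e by (intro gen_mult_eq) auto
    also have "q * gen e = q" by (simp add: q mult.assoc gen_idem E)
    finally have "opr q f = opr q (e * f)" using h2 by simp
    also have "\<dots> = opr p (e * f)"
      unfolding q_def using E
      by (intro opr_omega_r[OF reg p a]) (auto simp: idems_def simp flip: mult.assoc)
    finally show ?thesis by (simp add: q_def)
  qed
qed

text \<open>This is the relation \<open>[e, f] = [e, h, f]\<close> after \<open>e\<close> has acted,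
  which is what \<open>b * e = b\<close> expresses. The product of \<open>h\<close> and
  \<open>f\<close> is basic, and a sandwich element of \<open>b\<close> and \<open>h * f\<close> is
  also one of \<open>b\<close> and \<open>f\<close>.\<close>

lemma opr_sandwich:
  fixes e f :: "'a::semigroup_mult"
  assumes reg: "\<forall>x::'a. \<exists>y. x * y * x = x"
    and q: "lrel q b" and E: "b \<in> idems" "e \<in> idems" "f \<in> idems"
    and be: "b * e = b" and h: "h \<in> sandwich e f"
  shows "opr (opr q h) f = opr q f"
proof -
  note H = sandwichD[OF h E(2,3)]
  have bas: "basic_pair h f" using H E by (intro basic_pairI) auto
  have hf: "h * f \<in> idems" using bas by (rule basic_pair_idems)
  obtain k where k: "k \<in> sandwich b (h * f)" "opr q (h * f) = q * gen k * gen (h * f)"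
    using opr_lrel[OF reg q E(1) hf] .
  note K = sandwichD[OF k(1) E(1) hf]
  have ke: "k * e = k" using K(3) be by (metis mult.assoc)
  have khf: "k * (h * f) = k * f" using ke H(5) by (metis mult.assoc)
  have fk: "f * k = k" using K(4) H(4) by (metis mult.assoc)
  have "b * (h * f) = b * f" using be H(5) by (metis mult.assoc)
  then have "k \<in> sandwich b f" using K khf fk by (intro sandwichI) metis+
  then have "opr q f = q * gen k * gen f" using opr_eq q E by blast
  moreover have "gen k * gen (h * f) = gen (k * f)"
    using K hf khf by (intro gen_mult_eq) auto
  moreover have "gen k * gen f = gen (k * f)"
    using K E fk by (intro gen_mult_eq) auto
  ultimately have "opr q (h * f) = opr q f" using k by (simp add: mult.assoc)
  then show ?thesis using opr_basic[OF reg q E(1) bas] by simp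
qed

lemma opr_rig_rel:
  fixes u v :: "'a::semigroup_mult list"
  assumes reg: "\<forall>x::'a. \<exists>y. x * y * x = x"
    and p: "lrel p a" "a \<in> idems" and "rig_rel u v"
  shows "foldl opr p u = foldl opr p v"
  using assms(4)
proof cases
  case ig
  then show ?thesis using opr_basic[OF reg p] by (elim ig_relE) auto
next
  case (sw e f h)
  obtain h1 where h1: "h1 \<in> sandwich a e" "lrel (opr p e) (h1 * e)" "h1 * e \<in> idems"
    using opr_lrel[OF reg p sw(3)] .
  have "h1 * e * e = h1 * e" using sw(3) by (simp add: idems_def mult.assoc)
  then show ?thesis using opr_sandwich[OF reg h1(2,3) sw(3,4) _ sw(5)] sw by simp
qed

lemma foldl_opr_lrel:
  fixes u :: "'a::semigroup_mult list"
  assumes reg: "\<forall>x::'a. \<exists>y. x * y * x = x"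
  shows "set u \<subseteq> idems \<Longrightarrow> lrel p a \<Longrightarrow> a \<in> idems \<Longrightarrow> \<exists>b\<in>idems. lrel (foldl opr p u) b"
proof (induction u arbitrary: p a)
  case (Cons e u)
  have "e \<in> idems" using Cons.prems by simp
  then obtain h where "lrel (opr p e) (h * e)" "h * e \<in> idems"
    using opr_lrel[OF reg Cons.prems(2,3)] by metis
  then show ?case using Cons by simp
qed auto

lemma opr_eqRIG:
  fixes u v :: "'a::semigroup_mult list"
  assumes reg: "\<forall>x::'a. \<exists>y. x * y * x = x"
    and "eqRIG u v" "lrel p a" "a \<in> idems"
  shows "foldl opr p u = foldl opr p v"
  using assms(2)
proof (induction rule: cong_gen.induct)
  case (step u v x y)
  obtain b where "b \<in> idems" "lrel (foldl opr p x) b"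
    using foldl_opr_lrel[OF reg step(2) assms(3,4)] by blast
  then show ?case using opr_rig_rel[OF reg _ _ step(1)] by simp
qed auto

section \<open>Elements related to a letter are products of chains\<close>

text \<open>L-relatedness to \<open>f\<close> in S lifts to IG(E). Letters are added on the left; in
  front of each new product the letter \<open>k\<close> is exchanged for an R-related
  \<open>k'\<close> with \<open>k' * e = k'\<close>, so that \<open>e * k'\<close> is basic and
  L-related to \<open>k'\<close>.\<close>

lemma left_chain:
  assumes "set v \<subseteq> idems" "f \<in> idems" "z * ev (v @ [f]) = f"
  shows "\<exists>k\<in>idems. \<exists>y. y * (cl v * gen f) = gen f \<and> cl v * gen f * y = gen k"
  using assms
proof (induction v arbitrary: z)
  case Nil
  then show ?case by (auto intro!: bexI[of _ f] exI[of _ "gen f"] simp: gen_idem)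
next
  case (Cons e v)
  have E: "e \<in> idems" "f * f = f" using Cons.prems by (auto simp: idems_def)
  have z: "z * e * ev (v @ [f]) = f"
    using Cons.prems(3) by (simp add: ev_Cons mult.assoc)
  then obtain k y where k: "k \<in> idems"
    and y: "y * (cl v * gen f) = gen f" "cl v * gen f * y = gen k"
    using Cons.IH[of "z * e"] Cons.prems by auto
  obtain yl where yl: "y = cl yl" using cl_surj by blast
  \<comment> \<open>The added \<open>k\<close> keeps the right factor nonempty, as multiplicativity
    of \<open>ev\<close> requires.\<close>
  have "cl ((v @ [f]) @ (yl @ [k])) = cl [k]"
    using y k by (simp add: yl gen_idem flip: mult.assoc)
  from ev_mult_cl[OF this] have ky: "ev (v @ [f]) * ev (yl @ [k]) = k" by simp
  \<comment> \<open>\<open>t\<close> undoes, on \<open>k\<close>, the left multiplication by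
    \<open>e\<close>.\<close>
  define t where "t = ev (v @ [f]) * z"
  have "ev (v @ [f]) * f = ev (v @ [f])"
    using E by (cases "v = []") (auto simp: ev_append mult.assoc)
  then have tk: "t * (e * k) = k"
    unfolding t_def using ky z by (metis mult.assoc)
  define k' where "k' = k * (t * e)"
  have kk: "k * k = k" "e * e = e" using k E by (auto simp: idems_def)
  have k': "k' * k = k" "k * k' = k'" "k' * k' = k'" "k' * e = k'"
    unfolding k'_def using tk kk by (metis mult.assoc)+
  have k'I: "k' \<in> idems" using k' by (simp add: idems_def)
  have g: "gen k' * gen k = gen k" "gen k * gen k' = gen k'"
    using k k'I k' by (auto intro!: gen_mult_eq)
  have bas: "basic_pair e k'" using E k'I k' by (intro basic_pairI) auto
  have ek': "gen (e * k') = gen e * gen k'" using gen_mult[OF bas] by simp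
  have k'e: "gen k' * gen e = gen k'" using k'I E k' by (intro gen_mult_eq) auto
  let ?p = "cl v * gen f"
  have kp: "gen k * ?p = ?p"
    using y Cons.prems(2) by (metis mult.assoc gen_idem)
  then have k'p: "gen k' * ?p = ?p" using g by (metis mult.assoc)
  have "y * gen k' * (gen e * ?p) = gen f"
    using k'e k'p y by (metis mult.assoc)
  moreover have "gen e * ?p * (y * gen k') = gen (e * k')"
    using y g ek' by (metis mult.assoc)
  ultimately show ?case using basic_pair_idems(3)[OF bas]
    by (intro bexI[of _ "e * k'"] exI[of _ "y * gen k'"]) (simp_all add: mult.assoc)
qed

text \<open>The dual chain. Moreover each \<open>k'\<close> lies in the sandwich set of
  \<open>k\<close> and \<open>e\<close> and is absorbed by the product built so far, so the action
  of \<open>e\<close> is plain multiplication.\<close>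

lemma right_chain:
  assumes "set v \<subseteq> idems" "f \<in> idems" "ev (f # v) * z = f"
  shows "(\<exists>k\<in>idems. \<exists>y. gen f * cl v * y = gen f \<and> y * (gen f * cl v) = gen k) \<and>
    foldl opr (gen f) v = gen f * cl v"
  using assms
proof (induction v arbitrary: z rule: rev_induct)
  case Nil
  then show ?case by (auto intro!: bexI[of _ f] exI[of _ "gen f"] simp: gen_idem)
next
  case (snoc e v)
  have E: "e \<in> idems" "f * f = f" using snoc.prems by (auto simp: idems_def)
  have z: "ev (f # v) * (e * z) = f"
    using snoc.prems(3) ev_append[of "f # v" "[e]"] by (simp add: mult.assoc)
  then obtain k y where k: "k \<in> idems"
    and y: "gen f * cl v * y = gen f" "y * (gen f * cl v) = gen k"
    and IH: "foldl opr (gen f) v = gen f * cl v"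
    using snoc.IH[of "e * z"] snoc.prems by auto
  obtain yl where yl: "y = cl yl" using cl_surj by blast
  have "cl ((k # yl) @ (f # v)) = cl [k]"
    using y k by (simp add: yl gen_idem mult.assoc)
  from ev_mult_cl[OF this] have ky: "ev (k # yl) * ev (f # v) = k" by simp
  define t where "t = z * ev (f # v)"
  have "f * ev (f # v) = ev (f # v)"
    using E by (cases "v = []") (auto simp: ev_Cons left_assoc_eq[OF E(2)])
  then have tk: "k * (e * t) = k"
    unfolding t_def using ky z by (metis mult.assoc)
  define k' where "k' = e * (t * k)"
  have kk: "k * k = k" "e * e = e" using k E by (auto simp: idems_def)
  have k': "k * k' = k" "k' * k = k'" "k' * k' = k'" "e * k' = k'"
    unfolding k'_def using tk kk by (metis mult.assoc)+
  have k'I: "k' \<in> idems" using k' by (simp add: idems_def)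
  have g: "gen k * gen k' = gen k" "gen k' * gen k = gen k'"
    using k k'I k' by (auto intro!: gen_mult_eq)
  have bas: "basic_pair k' e" using E k'I k' by (intro basic_pairI) auto
  have k'e: "gen (k' * e) = gen k' * gen e" using gen_mult[OF bas] by simp
  have ek': "gen e * gen k' = gen k'" using k'I E k' by (intro gen_mult_eq) auto
  let ?p = "gen f * cl v"
  have pk: "?p * gen k = ?p"
    using y snoc.prems(2) by (metis mult.assoc gen_idem)
  then have pk': "?p * gen k' = ?p" using g by (metis mult.assoc)
  have 1: "?p * gen e * (gen k' * y) = gen f"
    using ek' pk' y by (metis mult.assoc)
  have 2: "gen k' * y * (?p * gen e) = gen (k' * e)"
    using y g k'e by (metis mult.assoc)
  have "lrel ?p k" using pk y by (auto simp: lrel_def)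
  moreover have "k' \<in> sandwich k e"
    using k' by (intro sandwichI) (simp_all flip: mult.assoc)
  ultimately have "opr ?p e = ?p * gen e"
    using opr_eq[of ?p k k' e] k E pk' by simp
  then show ?case using 1 2 basic_pair_idems(3)[OF bas] IH
    by (intro conjI bexI[of _ "k' * e"] exI[of _ "gen k' * y"]) (simp_all add: mult.assoc)
qed

text \<open>The chains on the two sides of \<open>c\<close> give letters \<open>k1\<close> R-related
  and \<open>k2\<close> L-related to the idempotent. In S they are so related to its value
  \<open>?a\<close>, hence the idempotent and \<open>gen ?a\<close> are H-related and
  coincide.\<close>

lemma idempotent_eq_gen:
  assumes v: "v \<in> words" and idem: "cl v * cl v = cl v"
  shows "cl v = gen (ev v)" "ev v \<in> idems"
proof -
  let ?u = "cl v" and ?a = "ev v"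
  have vne: "v \<noteq> []" using v by (simp add: words_def)
  have "ev (v @ v) = ev v" using idem by (intro ev_cl) simp
  then show a: "?a \<in> idems" using vne by (simp add: ev_append idems_def)
  obtain c l r where c: "c \<in> idems" and u: "?u = l * gen c * r" and "anchored l (gen c) r"
    using idempotent_meets_letter[OF assms] by (auto simp: meets_letter_def)
  then obtain z z' where z: "z * (l * gen c) = gen c" and z': "gen c * r * z' = gen c"
    by (auto simp: anchored_def)
  obtain ll rl zl zl' where li: "l = cl ll" "r = cl rl" "z = cl zl" "z' = cl zl'"
    using cl_surj by metis
  have "cl v = cl (ll @ [c] @ rl)" using u li by (simp add: mult.assoc)
  then have "set (ll @ [c] @ rl) \<subseteq> idems"
    using v cl_words unfolding words_def by blast
  then have sl: "set ll \<subseteq> idems" and sr: "set rl \<subseteq> idems" by auto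
  have "cl ((c # zl) @ (ll @ [c])) = cl [c]" using z li c by (simp add: mult.assoc gen_idem)
  from ev_mult_cl[OF this] have "ev (c # zl) * ev (ll @ [c]) = c" by simp
  from left_chain[OF sl c this] obtain k1 y1 where k1: "k1 \<in> idems"
    and y1: "y1 * (l * gen c) = gen c" "l * gen c * y1 = gen k1" using li by auto
  have "cl ((c # rl) @ (zl' @ [c])) = cl [c]"
    using z' li c by (simp add: gen_idem flip: mult.assoc)
  from ev_mult_cl[OF this] have "ev (c # rl) * ev (zl' @ [c]) = c" by simp
  from right_chain[OF sr c this] obtain k2 y2 where k2: "k2 \<in> idems"
    and y2: "gen c * r * y2 = gen c" "y2 * (gen c * r) = gen k2" using li by auto
  have cc: "gen c * gen c = gen c" using c by (rule gen_idem)
  have u': "?u = l * gen c * (gen c * r)" using u cc by (metis mult.assoc)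
  have k1u: "gen k1 * ?u = ?u" using y1 u cc by (metis mult.assoc)
  have "?u * (y2 * y1) = gen k1" using y1 y2 u by (metis mult.assoc)
  then have uk1: "?u * gen k1 = gen k1" using idem by (metis mult.assoc)
  have uk2: "?u * gen k2 = ?u" using y2 u cc by (metis mult.assoc)
  have "(y2 * y1) * ?u = gen k2" using y1 y2 u' cc by (metis mult.assoc)
  then have k2u: "gen k2 * ?u = gen k2" using idem by (metis mult.assoc)
  have S: "k1 * ?a = ?a" "?a * k1 = k1" "?a * k2 = ?a" "k2 * ?a = k2"
    using ev_mult_cl[of "[k1]" v v] ev_mult_cl[of v "[k1]" "[k1]"] ev_mult_cl[of v "[k2]" v]
      ev_mult_cl[of "[k2]" v "[k2]"] k1u uk1 uk2 k2u vne by simp_all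
  have "gen k1 * gen ?a = gen ?a" "gen k2 * gen ?a = gen k2"
    using S a k1 k2 by (auto intro!: gen_mult_eq)
  then show "?u = gen ?a" using uk1 uk2 by (metis mult.assoc)
qed

section \<open>Comparison with RIG(E)\<close>

lemma eqIG_imp_eqRIG: "eqIG u v \<Longrightarrow> eqRIG u v"
  by (induction rule: cong_gen.induct) (blast intro: cong_gen.intros rig_rel.ig)+

lemma eqRIG_append_right: "eqRIG u v \<Longrightarrow> set y \<subseteq> idems \<Longrightarrow> eqRIG (u @ y) (v @ y)"
proof (induction rule: cong_gen.induct)
  case (step u v p q)
  then show ?case using cong_gen.step[of rig_rel u v p "q @ y"] by simp
next
  case (refl w)
  then show ?case by (intro cong_gen.refl) (auto simp: words_def)
qed (blast intro: cong_gen.sym cong_gen.trans)+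

section \<open>Regular elements of IG(E) and their images in RIG(E)\<close>

lemma regular_of_lrel:
  assumes "w \<in> words" "f \<in> idems" "lrel (cl w) f"
  shows "regular_el eqIG w"
proof -
  obtain z where z: "z * cl w = gen f" using assms(3) by (auto simp: lrel_def)
  obtain zl where zl: "z = cl zl" using cl_surj by blast
  \<comment> \<open>The leading \<open>f\<close> makes the witness nonempty; comparison with
    \<open>[f]\<close> shows that all its letters lie in E.\<close>
  have "cl ((f # zl) @ w) = cl [f]" using z zl assms(2) by (simp add: mult.assoc gen_idem)
  moreover have "[f] \<in> words" using assms(2) by (simp add: words_def)
  ultimately have "(f # zl) @ w \<in> words" using cl_words by blast
  then have "f # zl \<in> words" by (simp add: words_def)
  moreover have "cl (w @ (f # zl) @ w) = cl w"
    using z zl assms(2,3) by (simp add: lrel_def gen_idem)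
  then have "eqIG (w @ (f # zl) @ w) w"
    using assms(1) cl_words eqIG_iff by blast
  ultimately show ?thesis using assms(1) unfolding regular_el_def by blast
qed

lemma regular_idempotents:
  assumes "regular_el eqIG s"
  obtains z k l where "s \<in> words" "z \<in> words" "k \<in> idems" "l \<in> idems"
    "cl s * cl z = gen k" "cl z * cl s = gen l" "gen k * cl s = cl s" "cl s * gen l = cl s"
proof -
  obtain z where w: "s \<in> words" "z \<in> words" and z: "cl s * cl z * cl s = cl s"
    using assms by (auto simp: regular_el_def eqIG_iff mult.assoc)
  have "s @ z \<in> words" "z @ s \<in> words" using w by (auto simp: words_def)
  moreover have "cl (s @ z) * cl (s @ z) = cl (s @ z)" "cl (z @ s) * cl (z @ s) = cl (z @ s)"
    using z by (simp_all add: mult.assoc) (metis mult.assoc)+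
  ultimately have "cl (s @ z) = gen (ev (s @ z))" "ev (s @ z) \<in> idems"
    "cl (z @ s) = gen (ev (z @ s))" "ev (z @ s) \<in> idems"
    using idempotent_eq_gen by blast+
  then show ?thesis using that w z by (metis cl_append mult.assoc)
qed

lemma foldl_opr_eq_cl:
  assumes "s \<in> words" "k \<in> idems" "gen k * cl s = cl s" "cl s * z = gen k"
  shows "foldl opr (gen k) s = cl s"
proof -
  obtain zl where zl: "z = cl zl" using cl_surj by blast
  have "cl ((k # s) @ (zl @ [k])) = cl [k]"
    using assms zl by (simp add: gen_idem flip: mult.assoc)
  from ev_mult_cl[OF this] have "ev (k # s) * ev (zl @ [k]) = k" by simp
  then show ?thesis using right_chain[of s k] assms by (auto simp: words_def)
qed

text \<open>Equal values in S make \<open>k\<close> and \<open>k'\<close> R-related, so both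
  elements are R-related to the same letter \<open>k\<close>. Both are then obtained from
  \<open>gen k\<close> by the action of words that are equal in RIG(E).\<close>

lemma eqRIG_regular_imp_eqIG:
  fixes s s' :: "'a::semigroup_mult list"
  assumes reg: "\<forall>x::'a. \<exists>y. x * y * x = x"
    and s: "regular_el eqIG s" and s': "regular_el eqIG s'" and eq: "eqRIG s s'"
  shows "eqIG s s'"
proof -
  obtain z k l where z: "s \<in> words" "z \<in> words" "k \<in> idems"
    "cl s * cl z = gen k" "gen k * cl s = cl s"
    using regular_idempotents[OF s] .
  obtain z' k' l' where z': "s' \<in> words" "z' \<in> words" "k' \<in> idems"
    "cl s' * cl z' = gen k'" "gen k' * cl s' = cl s'"
    using regular_idempotents[OF s'] .
  have ne: "s \<noteq> []" "z \<noteq> []" "s' \<noteq> []" "z' \<noteq> []" using z z' by (auto simp: words_def)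
  have ev: "ev s = ev s'" using eq by (rule ev_eqRIG)
  have "ev s * ev z = k" "k * ev s = ev s" "ev s' * ev z' = k'" "k' * ev s' = ev s'"
    using ev_mult_cl[of s z "[k]"] ev_mult_cl[of "[k]" s s] ev_mult_cl[of s' z' "[k']"]
      ev_mult_cl[of "[k']" s' s'] z z' ne by simp_all
  then have kk: "k * k' = k'" "k' * k = k" using ev by (metis mult.assoc)+
  have g: "gen k * gen k' = gen k'" "gen k' * gen k = gen k"
    using kk z z' by (auto intro!: gen_mult_eq)
  have 1: "gen k * cl s' = cl s'" using g z' by (metis mult.assoc)
  have 2: "cl s' * (cl z' * gen k) = gen k" using g z' by (metis mult.assoc)
  have "lrel (gen k) k" using z gen_idem by (auto simp: lrel_def)
  then have "foldl opr (gen k) s = foldl opr (gen k) s'"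
    using opr_eqRIG[OF reg eq] z by blast
  then have "cl s = cl s'"
    using foldl_opr_eq_cl[OF z(1,3,5,4)] foldl_opr_eq_cl[OF z'(1) z(3) 1 2] by simp
  then show ?thesis using z by (simp add: eqIG_iff)
qed

lemma regular_preimage:
  fixes r :: "'a::semigroup_mult list"
  assumes reg: "\<forall>x::'a. \<exists>y. x * y * x = x" and "r \<in> words"
  shows "\<exists>w. regular_el eqIG w \<and> eqRIG w r"
proof -
  have "r \<noteq> []" "set r \<subseteq> idems" using assms by (auto simp: words_def)
  then have "\<exists>w\<in>words. \<exists>f\<in>idems. lrel (cl w) f \<and> eqRIG w r"
  proof (induction r rule: rev_nonempty_induct)
    case (single e)
    then have "lrel (cl [e]) e"
      by (auto simp: lrel_def gen_idem intro!: exI[of _ 1])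
    moreover have "eqRIG [e] [e]" "[e] \<in> words" "e \<in> idems"
      using single by (auto simp: words_def intro!: cong_gen.refl)
    ultimately show ?case by blast
  next
    case (snoc e r)
    then obtain w f where w: "w \<in> words" "f \<in> idems" "lrel (cl w) f" "eqRIG w r"
      and e: "e \<in> idems" by auto
    obtain h where h: "h \<in> sandwich f e" using sandwich_nonempty[OF reg w(2) e] .
    have hI: "h \<in> idems" using h by (simp add: sandwich_def)
    have wf: "cl w * gen f = cl w" using w by (simp add: lrel_def)
    have W: "w @ [h, e] \<in> words" "w @ [e] \<in> words" "set w \<subseteq> idems"
      using w e hI by (auto simp: words_def)
    \<comment> \<open>As \<open>cl w\<close> absorbs \<open>f\<close>, this letter can be supplied
      on both sides, which makes the sandwich relation of RIG(E) applicable.\<close>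
    have "cl (w @ [h, e]) = cl (w @ [f, h, e])" "cl (w @ [e]) = cl (w @ [f, e])"
      using wf by (simp_all flip: mult.assoc)
    then have "eqRIG (w @ [h, e]) (w @ [f, h, e])" "eqRIG (w @ [e]) (w @ [f, e])"
      using W by (auto intro!: eqIG_imp_eqRIG simp: eqIG_iff)
    moreover have "eqRIG (w @ [f, e]) (w @ [f, h, e])"
      using cong_gen.step[of rig_rel "[f, e]" "[f, h, e]" w "[]"] rig_rel.sw[OF w(2) e h] W(3)
      by simp
    ultimately have "eqRIG (w @ [h, e]) (w @ [e])"
      by (meson cong_gen.sym cong_gen.trans)
    moreover have "eqRIG (w @ [e]) (r @ [e])"
      using w(4) e by (intro eqRIG_append_right) auto
    ultimately have "eqRIG (w @ [h, e]) (r @ [e])" by (rule cong_gen.trans)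
    moreover have "lrel (cl (w @ [h, e])) (h * e)"
      using lrel_sandwich[OF w(3) h w(2) e] by (simp add: mult.assoc)
    ultimately show ?case using W(1) sandwich_mult_idems[OF h w(2) e] by blast
  qed
  then show ?thesis using regular_of_lrel by blast
qed

section \<open>Maximal subgroups\<close>

lemma in_maxsub_imp_regular:
  assumes "in_maxsub eqIG e s" "e \<in> idems"
  shows "regular_el eqIG s"
proof -
  obtain t v where s: "s \<in> words" "v \<in> words" and t: "cl s = gen e * cl t * gen e"
    and v: "cl s * cl v = gen e"
    using assms(1) by (auto simp: in_maxsub_def eqIG_iff mult.assoc)
  have "gen e * cl s = cl s" unfolding t using assms(2) by (simp add: gen_idem_left mult.assoc)
  then have "cl (s @ v @ s) = cl s" using v by (simp flip: mult.assoc)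
  moreover have "s @ v @ s \<in> words" using s by (auto simp: words_def)
  ultimately show ?thesis using s by (auto simp: regular_el_def eqIG_iff)
qed

text \<open>The value of \<open>s\<close> lies in the H-class of \<open>e\<close> in S, so
  \<open>k\<close> is R-related and \<open>l\<close> is L-related to \<open>e\<close>. Basic
  products carry both relations to IG(E).\<close>

lemma in_maxsub_lift:
  assumes r: "in_maxsub eqRIG e r" and e: "e \<in> idems"
    and s: "regular_el eqIG s" and eq: "eqRIG s r"
  shows "in_maxsub eqIG e s"
proof -
  obtain t v where tv: "r \<in> words" "t \<in> words" "v \<in> words"
    and rel: "eqRIG r ([e] @ t @ [e])" "eqRIG (r @ v) [e]" "eqRIG (v @ r) [e]"
    using r by (auto simp: in_maxsub_def)
  obtain z k l where z: "s \<in> words" "z \<in> words" "k \<in> idems" "l \<in> idems"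
    "cl s * cl z = gen k" "cl z * cl s = gen l" "gen k * cl s = cl s" "cl s * gen l = cl s"
    using regular_idempotents[OF s] .
  have ne: "r \<noteq> []" "t \<noteq> []" "v \<noteq> []" "s \<noteq> []" "z \<noteq> []" using tv z by (auto simp: words_def)
  let ?x = "ev s"
  have x: "?x = ev r" using eq by (rule ev_eqRIG)
  have ee: "e * e = e" using e by (simp add: idems_def)
  have "?x = e * (ev t * e)" "?x * ev v = e" "ev v * ?x = e"
    using rel[THEN ev_eqRIG] ne unfolding x by (simp_all add: ev_append ev_Cons)
  moreover have "?x * ev z = k" "ev z * ?x = l" "k * ?x = ?x" "?x * l = ?x"
    using ev_mult_cl[of s z "[k]"] ev_mult_cl[of z s "[l]"] ev_mult_cl[of "[k]" s s]
      ev_mult_cl[of s "[l]" s] z ne by simp_all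
  ultimately have S: "e * k = k" "k * e = e" "l * e = l" "e * l = e"
    using ee by (metis mult.assoc)+
  have g: "gen e * gen k = gen k" "gen k * gen e = gen e" "gen l * gen e = gen l"
    "gen e * gen l = gen e"
    using S e z by (auto intro!: gen_mult_eq)
  have es: "gen e * cl s = cl s" and se: "cl s * gen e = cl s"
    using g z by (metis mult.assoc)+
  \<comment> \<open>The inverse in the group: \<open>z\<close>, which inverts \<open>s\<close> up to
    the letters \<open>k\<close> and \<open>l\<close>, cut down to the local monoid of
    \<open>e\<close>.\<close>
  let ?v = "[e] @ z @ [e]"
  have W: "?v \<in> words" "s @ ?v \<in> words" "?v @ s \<in> words" using z e by (auto simp: words_def)
  have "eqIG s ([e] @ s @ [e])" using z es se by (simp add: eqIG_iff)
  moreover have "eqIG ?v ([e] @ z @ [e])" using W by (simp add: eqIG_iff)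
  moreover have "cl (s @ ?v) = gen e" "cl (?v @ s) = gen e"
    using es se z g by (simp_all add: mult.assoc) (metis mult.assoc)+
  then have "eqIG (s @ ?v) [e]" "eqIG (?v @ s) [e]" using W by (simp_all add: eqIG_iff)
  ultimately show ?thesis unfolding in_maxsub_def using z W by blast
qed

theorem mainTheorem2:
  assumes regular: "\<forall>x::'a::semigroup_mult. \<exists>y. x * y * x = x"
  shows "(\<forall>r \<in> (words :: 'a list set).
            \<exists>s. regular_el eqIG s \<and> eqRIG s r \<and>
                (\<forall>s'. regular_el eqIG s' \<and> eqRIG s' r \<longrightarrow> eqIG s' s))
       \<and> (\<forall>e \<in> (idems :: 'a set).
            (\<forall>s. in_maxsub eqIG e s \<longrightarrow> in_maxsub eqRIG e s)
          \<and> (\<forall>r. in_maxsub eqRIG e r \<longrightarrow> (\<exists>s. in_maxsub eqIG e s \<and> eqRIG s r))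
          \<and> (\<forall>s s'. in_maxsub eqIG e s \<and> in_maxsub eqIG e s' \<and> eqRIG s s' \<longrightarrow> eqIG s s'))"
proof (intro conjI ballI)
  fix r :: "'a list" assume r: "r \<in> words"
  then obtain s where s: "regular_el eqIG s" "eqRIG s r" using regular_preimage[OF regular] by blast
  have "eqIG s' s" if "regular_el eqIG s'" "eqRIG s' r" for s'
    using that s eqRIG_regular_imp_eqIG[OF regular] cong_gen.sym cong_gen.trans by metis
  then show "\<exists>s. regular_el eqIG s \<and> eqRIG s r \<and>
      (\<forall>s'. regular_el eqIG s' \<and> eqRIG s' r \<longrightarrow> eqIG s' s)"
    using s by blast
next
  fix e :: 'a assume e: "e \<in> idems"
  show "\<forall>s. in_maxsub eqIG e s \<longrightarrow> in_maxsub eqRIG e s"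
    unfolding in_maxsub_def by (meson eqIG_imp_eqRIG)
  show "\<forall>r. in_maxsub eqRIG e r \<longrightarrow> (\<exists>s. in_maxsub eqIG e s \<and> eqRIG s r)"
  proof (intro allI impI)
    fix r assume r: "in_maxsub eqRIG e r"
    then have "r \<in> words" by (simp add: in_maxsub_def)
    then obtain s where "regular_el eqIG s" "eqRIG s r" using regular_preimage[OF regular] by blast
    then show "\<exists>s. in_maxsub eqIG e s \<and> eqRIG s r" using in_maxsub_lift[OF r e] by blast
  qed
  show "\<forall>s s'. in_maxsub eqIG e s \<and> in_maxsub eqIG e s' \<and> eqRIG s s' \<longrightarrow> eqIG s s'"
    by (meson in_maxsub_imp_regular[OF _ e] eqRIG_regular_imp_eqIG[OF regular])
qed

end
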